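(* Let $n\ge 2$, let $X=\sum_{i=1}^n a_i\,\partial/\partial\theta_i$ be a constant vector field on $T^n$ whose coefficients $a_1,\dots,a_n\in\mathbb{R}$ are independent over $\mathbb{Q}$, and let $\phi$ be the flow on $T^n$ generated by $X$. For each subgroup $\Lambda<\rho_\phi(S_\phi)$ let $h_\Lambda:\Lambda\to\rho_\phi^{-1}(\Lambda)$ be the map $h_\Lambda(\alpha)=R$, where $R$ is the diffeomorphism of $T^n$ having $\hat R(x)=\nu_\phi^{-1}(\alpha)x$ ($x\in\mathbb{R}^n$) as a lift. Then for each $\Lambda<\rho_\phi(S_\phi)$, $h_\Lambda$ is a splitting map for the extension $$\mathrm{id}_{T^n}\to\ker\rho_\phi\to\rho_\phi^{-1}(\Lambda)\xrightarrow{\,j_\Lambda\,}\Lambda\to 1,$$ that is, $h_\Lambda$ is a group homomorphism and $j_\Lambda h_\Lambda$ is the identity of $\Lambda$.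
   Context: $T^n=\mathbb{R}^n/\mathbb{Z}^n$ with coordinates $\theta_i=x_i\bmod 1$ and covering map $\pi:\mathbb{R}^n\to T^n$. $\mathrm{Diff}(T^n)$ is the group of $C^\infty$ diffeomorphisms of $T^n$. Real numbers $a_1,\dots,a_n$ are independent over $\mathbb{Q}$ if $\sum_j m_ja_j=0$ with $m_j\in\mathbb{Z}$ implies all $m_j=0$. For a flow $\phi$ generated by $X$, $F_\phi=\{\phi_t:t\in\mathbb{R}\}$ and $S_\phi$ is the normalizer of $F_\phi$ in $\mathrm{Diff}(T^n)$. For $R\in\mathrm{Diff}(T^n)$, $R_*X=\mathbf{T}R\circ X\circ R^{-1}$, where $\mathbf{T}$ is the tangent functor. It is known that $R\in S_\phi$ if and only if there is a unique $\alpha\in\mathbb{R}^*=\mathbb{R}\setminus\{0\}$ with $R_*X=\alpha X$ (equivalently $R\phi_t=\phi_{\alpha t}R$ for all $t$); the homomorphism $\rho_\phi:S_\phi\to\mathbb{R}^*$ sends $R$ to this $\alpha$. A lift of $R$ is a continuous $\hat R:\mathbb{R}^n\to\mathbb{R}^n$ with $R\pi=\pi\hat R$; any two lifts differ by translation by an element of $\mathbb{Z}^n$. Let $\Pi_\phi=\{B\in\mathrm{GL}(n,\mathbb{Z}): B=\mathbf{T}\hat R \text{ for an } R\in S_\phi\}$, where $\mathbf{T}\hat R=B$ means that the derivative of the lift $\hat R$ is the constant matrix $B$. The map $\nu_\phi:\Pi_\phi\to\rho_\phi(S_\phi)$, $\nu_\phi(B)=\rho_\phi(R)$ where $R\in S_\phi$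 with $\mathbf{T}\hat R=B$, is a well-defined group isomorphism under the stated hypotheses. In the extension, $\ker\rho_\phi\to\rho_\phi^{-1}(\Lambda)$ is the inclusion and $j_\Lambda$ is the restriction of $\rho_\phi$ to $\rho_\phi^{-1}(\Lambda)$. "$<$" denotes "is a subgroup of" (not necessarily proper). *)

theory Defs
  imports "HOL-Analysis.Analysis" "HOL-Algebra.Group_Action"
begin

section \<open>The torus\<close>

definition lattice_equiv :: "real ^ 'n \<Rightarrow> real ^ 'n \<Rightarrow> bool" where
  "lattice_equiv x y \<longleftrightarrow> (\<forall>i. x $ i - y $ i \<in> \<int>)"

lemma equivp_lattice_equiv: "equivp (lattice_equiv :: real ^ 'n \<Rightarrow> real ^ 'n \<Rightarrow> bool)"
proof (rule equivpI)
  show "reflp (lattice_equiv :: real ^ 'n \<Rightarrow> real ^ 'n \<Rightarrow> bool)"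
    by (simp add: reflp_def lattice_equiv_def)
  show "symp (lattice_equiv :: real ^ 'n \<Rightarrow> real ^ 'n \<Rightarrow> bool)"
    unfolding symp_def lattice_equiv_def by (metis Ints_minus minus_diff_eq)
  show "transp (lattice_equiv :: real ^ 'n \<Rightarrow> real ^ 'n \<Rightarrow> bool)"
  proof (rule transpI)
    fix x y z :: "real ^ 'n"
    assume *: "lattice_equiv x y" "lattice_equiv y z"
    show "lattice_equiv x z"
      unfolding lattice_equiv_def
    proof
      fix i
      have "(x $ i - y $ i) + (y $ i - z $ i) \<in> \<int>"
        using * by (intro Ints_add) (auto simp: lattice_equiv_def)
      then show "x $ i - z $ i \<in> \<int>" by simp
    qed
  qed
qed

quotient_type (overloaded) 'n torus = "real ^ ('n::finite)" / lattice_equiv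
  by (rule equivp_lattice_equiv)

lift_definition torus_proj :: "real ^ 'n \<Rightarrow> ('n::finite) torus" is "\<lambda>x. x" .

section \<open>Smooth maps, tangent maps and vector fields\<close>

text \<open>
  The smooth structure of the torus is the one for which \<^const>\<open>torus_proj\<close> is a local
  diffeomorphism, so local inverses of \<^const>\<open>torus_proj\<close> are the charts, and a coordinate
  expression of a map is a local lift of it.  The same coordinates identify every tangent
  space with \<open>real ^ 'n\<close>, the basis being the coordinate fields \<open>\<partial>/\<partial>\<theta>\<^sub>i\<close>; a vector field
  is thus a map from the torus to \<open>real ^ 'n\<close>.
\<close>

primrec Ck_on ::
  "nat \<Rightarrow> 'a::real_normed_vector set \<Rightarrow> ('a \<Rightarrow> 'b::real_normed_vector) \<Rightarrow> bool" where
  "Ck_on 0 U f \<longleftrightarrow> continuous_on U f"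
| "Ck_on (Suc k) U f \<longleftrightarrow> (\<forall>x\<in>U. f differentiable at x) \<and>
     (\<forall>v. Ck_on k U (\<lambda>x. frechet_derivative f (at x) v))"

definition torus_smooth :: "('n::finite torus \<Rightarrow> 'n torus) \<Rightarrow> bool" where
  "torus_smooth R \<longleftrightarrow> (\<forall>x. \<exists>U g. open U \<and> x \<in> U \<and> (\<forall>k. Ck_on k U g) \<and>
     (\<forall>y\<in>U. R (torus_proj y) = torus_proj (g y)))"

definition torus_diffeo :: "('n::finite torus \<Rightarrow> 'n torus) \<Rightarrow> bool" where
  "torus_diffeo R \<longleftrightarrow> bij R \<and> torus_smooth R \<and> torus_smooth (inv_into UNIV R)"

definition Diff_torus :: "('n::finite torus \<Rightarrow> 'n torus) monoid" where
  "Diff_torus = \<lparr>carrier = {R. torus_diffeo R}, mult = (\<circ>), one = id\<rparr>"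

definition tangent_map :: "('n::finite torus \<Rightarrow> 'n torus) \<Rightarrow> 'n torus \<Rightarrow> real ^ 'n \<Rightarrow> real ^ 'n" where
  "tangent_map R p = (THE D. \<exists>x g. torus_proj x = p \<and>
     (\<forall>\<^sub>F y in nhds x. R (torus_proj y) = torus_proj (g y)) \<and> (g has_derivative D) (at x))"

definition pushforward ::
  "('n::finite torus \<Rightarrow> 'n torus) \<Rightarrow> ('n torus \<Rightarrow> real ^ 'n) \<Rightarrow> 'n torus \<Rightarrow> real ^ 'n" where
  "pushforward R X p = tangent_map R (inv_into UNIV R p) (X (inv_into UNIV R p))"

definition constant_field :: "real ^ 'n \<Rightarrow> ('n::finite) torus \<Rightarrow> real ^ 'n" where
  "constant_field a = (\<lambda>p. a)"

definition has_velocity :: "(real \<Rightarrow> 'n::finite torus) \<Rightarrow> real \<Rightarrow> real ^ 'n \<Rightarrow> bool" where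
  "has_velocity c t v \<longleftrightarrow> (\<exists>\<gamma>. (\<forall>\<^sub>F s in nhds t. c s = torus_proj (\<gamma> s)) \<and>
     (\<gamma> has_vector_derivative v) (at t))"

text \<open>
  The group law of the flow is not listed: it follows from uniqueness of integral curves.
\<close>

definition flow_generated_by ::
  "(real \<Rightarrow> 'n::finite torus \<Rightarrow> 'n torus) \<Rightarrow> ('n torus \<Rightarrow> real ^ 'n) \<Rightarrow> bool" where
  "flow_generated_by \<phi> X \<longleftrightarrow> (\<forall>p. \<phi> 0 p = p) \<and>
     (\<forall>p t. has_velocity (\<lambda>s. \<phi> s p) t (X (\<phi> t p)))"

definition rationally_independent :: "real ^ 'n::finite \<Rightarrow> bool" where
  "rationally_independent a \<longleftrightarrow>
     (\<forall>m::'n \<Rightarrow> int. (\<Sum>j\<in>UNIV. of_int (m j) * a $ j) = 0 \<longrightarrow> (\<forall>j. m j = 0))"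

section \<open>Generalized symmetries of a flow\<close>

definition flow_maps :: "(real \<Rightarrow> 'n::finite torus \<Rightarrow> 'n torus) \<Rightarrow> ('n torus \<Rightarrow> 'n torus) set" where
  "flow_maps \<phi> = range \<phi>"

definition flow_symmetries ::
  "(real \<Rightarrow> 'n::finite torus \<Rightarrow> 'n torus) \<Rightarrow> ('n torus \<Rightarrow> 'n torus) set" where
  "flow_symmetries \<phi> = normalizer Diff_torus (flow_maps \<phi>)"

definition Rstar :: "real monoid" where
  "Rstar = \<lparr>carrier = UNIV - {0}, mult = (*), one = 1\<rparr>"

text \<open>
  The following is \<open>\<rho>\<^sub>\<phi>\<close>; it depends on the flow only through its generator \<open>X\<close>, and is
  meaningful on \<^term>\<open>flow_symmetries \<phi>\<close>.
\<close>

definition multiplier :: "('n::finite torus \<Rightarrow> real ^ 'n) \<Rightarrow> ('n torus \<Rightarrow> 'n torus) \<Rightarrow> real" where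
  "multiplier X R = (THE \<alpha>. \<alpha> \<noteq> 0 \<and> pushforward R X = (\<lambda>p. \<alpha> *\<^sub>R X p))"

definition multiplier_group ::
  "(real \<Rightarrow> 'n::finite torus \<Rightarrow> 'n torus) \<Rightarrow> ('n torus \<Rightarrow> real ^ 'n) \<Rightarrow> real monoid" where
  "multiplier_group \<phi> X = Rstar\<lparr>carrier := multiplier X ` flow_symmetries \<phi>\<rparr>"

definition is_lift :: "(real ^ 'n \<Rightarrow> real ^ 'n) \<Rightarrow> ('n::finite torus \<Rightarrow> 'n torus) \<Rightarrow> bool" where
  "is_lift L R \<longleftrightarrow> continuous_on UNIV L \<and> (\<forall>x. R (torus_proj x) = torus_proj (L x))"

abbreviation int_matrix_map :: "int ^ 'n ^ 'n \<Rightarrow> real ^ 'n \<Rightarrow> real ^ 'n" where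
  "int_matrix_map B \<equiv> (*v) (map_matrix of_int B)"

definition lift_derivative_is :: "('n::finite torus \<Rightarrow> 'n torus) \<Rightarrow> int ^ 'n ^ 'n \<Rightarrow> bool" where
  "lift_derivative_is R B \<longleftrightarrow>
     (\<exists>L. is_lift L R \<and> (\<forall>x. (L has_derivative int_matrix_map B) (at x)))"

text \<open>
  \<open>GL(n, \<int>)\<close> consists of the matrices that are \<^const>\<open>invertible\<close> over the ring
  \<^typ>\<open>int\<close>.  The next two definitions are \<open>\<Pi>\<^sub>\<phi>\<close> and \<open>\<nu>\<^sub>\<phi>\<close>.
\<close>

definition symmetry_matrices ::
  "(real \<Rightarrow> 'n::finite torus \<Rightarrow> 'n torus) \<Rightarrow> (int ^ 'n ^ 'n) set" where
  "symmetry_matrices \<phi> = {B. invertible B \<and> (\<exists>R\<in>flow_symmetries \<phi>. lift_derivative_is R B)}"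

definition matrix_multiplier ::
  "(real \<Rightarrow> 'n::finite torus \<Rightarrow> 'n torus) \<Rightarrow> ('n torus \<Rightarrow> real ^ 'n) \<Rightarrow> int ^ 'n ^ 'n \<Rightarrow> real" where
  "matrix_multiplier \<phi> X B =
     (THE \<alpha>. \<exists>R\<in>flow_symmetries \<phi>. lift_derivative_is R B \<and> \<alpha> = multiplier X R)"

definition multiplier_matrix ::
  "(real \<Rightarrow> 'n::finite torus \<Rightarrow> 'n torus) \<Rightarrow> ('n torus \<Rightarrow> real ^ 'n) \<Rightarrow> real \<Rightarrow> int ^ 'n ^ 'n" where
  "multiplier_matrix \<phi> X = inv_into (symmetry_matrices \<phi>) (matrix_multiplier \<phi> X)"

section \<open>The extension and the section\<close>

definition symmetries_over ::
  "(real \<Rightarrow> 'n::finite torus \<Rightarrow> 'n torus) \<Rightarrow> ('n torus \<Rightarrow> real ^ 'n) \<Rightarrow> real set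
    \<Rightarrow> ('n torus \<Rightarrow> 'n torus) monoid" where
  "symmetries_over \<phi> X \<Lambda> =
     Diff_torus\<lparr>carrier := {R \<in> flow_symmetries \<phi>. multiplier X R \<in> \<Lambda>}\<rparr>"

definition multiplier_kernel ::
  "(real \<Rightarrow> 'n::finite torus \<Rightarrow> 'n torus) \<Rightarrow> ('n torus \<Rightarrow> real ^ 'n)
    \<Rightarrow> ('n torus \<Rightarrow> 'n torus) monoid" where
  "multiplier_kernel \<phi> X = Diff_torus\<lparr>carrier :=
     kernel (Diff_torus\<lparr>carrier := flow_symmetries \<phi>\<rparr>) Rstar (multiplier X)\<rparr>"

definition multiplier_on ::
  "(real \<Rightarrow> 'n::finite torus \<Rightarrow> 'n torus) \<Rightarrow> ('n torus \<Rightarrow> real ^ 'n) \<Rightarrow> real set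
    \<Rightarrow> ('n torus \<Rightarrow> 'n torus) \<Rightarrow> real" where
  "multiplier_on \<phi> X \<Lambda> = restrict (multiplier X) (carrier (symmetries_over \<phi> X \<Lambda>))"

definition linear_section ::
  "(real \<Rightarrow> 'n::finite torus \<Rightarrow> 'n torus) \<Rightarrow> ('n torus \<Rightarrow> real ^ 'n) \<Rightarrow> real set
    \<Rightarrow> real \<Rightarrow> ('n torus \<Rightarrow> 'n torus)" where
  "linear_section \<phi> X \<Lambda> = (\<lambda>\<alpha>\<in>\<Lambda>.
     THE R. torus_diffeo R \<and> is_lift (int_matrix_map (multiplier_matrix \<phi> X \<alpha>)) R)"

text \<open>
  \<open>1 \<rightarrow> K \<rightarrow> E \<rightarrow> Q \<rightarrow> 1\<close> with maps \<open>i\<close> and \<open>j\<close>.  (The library's \<open>short_exact_sequence\<close> forces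
  all groups to live on one type.)
\<close>

definition group_extension ::
  "'a monoid \<Rightarrow> ('a \<Rightarrow> 'b) \<Rightarrow> 'b monoid \<Rightarrow> ('b \<Rightarrow> 'c) \<Rightarrow> 'c monoid \<Rightarrow> bool" where
  "group_extension K i E j Q \<longleftrightarrow> group_hom K E i \<and> group_hom E Q j \<and>
     inj_on i (carrier K) \<and> i ` carrier K = kernel E Q j \<and> j ` carrier E = carrier Q"

definition splitting_map ::
  "'a monoid \<Rightarrow> ('a \<Rightarrow> 'b) \<Rightarrow> 'b monoid \<Rightarrow> ('b \<Rightarrow> 'c) \<Rightarrow> 'c monoid \<Rightarrow> ('c \<Rightarrow> 'b) \<Rightarrow> bool" where
  "splitting_map K i E j Q h \<longleftrightarrow>
     group_extension K i E j Q \<and> h \<in> hom Q E \<and> (\<forall>\<alpha>\<in>carrier Q. j (h \<alpha>) = \<alpha>)"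

end

theory Submission
  imports Defs
begin

text \<open>
  The flow acts by the translations \<open>x \<mapsto> x + t a\<close>, and by Kronecker's theorem the orbit of \<open>0\<close>
  is dense.  A diffeomorphism \<open>R\<close> normalizing these translations satisfies
  \<open>R (x + t a) = R x + s(t) a\<close>, so by density \<open>R (x + y) - R x = R y - R 0\<close> for all \<open>x, y\<close>.
  Hence \<open>R\<close> lifts to an affine map \<open>B x + c\<close> with \<open>B\<close> integral, and the same holds for the
  inverse, so \<open>B\<close> is in \<open>GL(n, \<int>)\<close>; moreover \<open>B a = \<alpha> a\<close>.  Conversely every such affine map is a
  symmetry with multiplier \<open>\<alpha>\<close>.  Rational independence makes \<open>B\<close> a function of \<open>\<alpha>\<close>, and the
  maps with \<open>c = 0\<close> compose like their matrices.
\<close>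

section \<open>Characters of the torus\<close>

lemma torus_proj_eq_iff: "torus_proj x = torus_proj y \<longleftrightarrow> (\<forall>i. x $ i - y $ i \<in> \<int>)"
  by transfer (simp add: lattice_equiv_def)

lemma torus_cases: obtains x where "p = torus_proj x"
  by (metis Quotient3_abs_rep Quotient3_torus torus_proj.abs_eq)

lemma cis_2pi_eq_iff: "cis (2 * pi * s) = cis (2 * pi * t) \<longleftrightarrow> s - t \<in> \<int>"
proof
  assume "cis (2 * pi * s) = cis (2 * pi * t)"
  then have "cis (2 * pi * s) / cis (2 * pi * t) = 1"
    by simp
  then have "cis (2 * pi * (s - t)) = 1"
    by (simp add: cis_divide right_diff_distrib)
  then have "cos (2 * pi * (s - t)) = 1"
    by (metis cis.simps(1) one_complex.simps(1))
  then obtain k :: int where "2 * pi * (s - t) = of_int k * 2 * pi"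
    by (auto simp: cos_one_2pi_int)
  then have "s - t = of_int k"
    by simp
  then show "s - t \<in> \<int>"
    by simp
next
  assume "s - t \<in> \<int>"
  then have "cis (2 * pi * (s - t)) * cis (2 * pi * t) = cis (2 * pi * t)"
    by simp
  then show "cis (2 * pi * s) = cis (2 * pi * t)"
    by (simp add: cis_mult algebra_simps)
qed

text \<open>The characters \<open>exp (2 pi i x_i)\<close>. Together they embed the torus in complex
  n-space, where products, limits and derivatives are available.\<close>

lift_definition torus_char :: "'n::finite torus \<Rightarrow> 'n \<Rightarrow> complex" is "\<lambda>x i. cis (2 * pi * x $ i)"
  by (simp add: lattice_equiv_def fun_eq_iff cis_2pi_eq_iff)

lemma torus_char_proj: "torus_char (torus_proj x) i = cis (2 * pi * x $ i)"
  by transfer rule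

lemma torus_char_inject: "torus_char p = torus_char q \<Longrightarrow> p = q"
  by transfer (simp add: lattice_equiv_def fun_eq_iff cis_2pi_eq_iff)

lemma has_derivative_cis_component:
  fixes g :: "'a::real_normed_vector \<Rightarrow> real ^ 'n"
  assumes "(g has_derivative D) (at x within S)"
  shows "((\<lambda>y. cis (2 * pi * g y $ i)) has_derivative
    (\<lambda>h. cis (2 * pi * g x $ i) * (\<i> * of_real (2 * pi * D h $ i)))) (at x within S)"
proof -
  have "((\<lambda>y. \<i> * of_real (2 * pi * g y $ i)) has_derivative
      (\<lambda>h. \<i> * of_real (2 * pi * D h $ i))) (at x within S)"
    by (intro has_derivative_mult_right has_derivative_of_real
        bounded_linear.has_derivative[OF bounded_linear_vec_nth] assms)
  from has_derivative_compose[OF this has_field_derivative_imp_has_derivative[OF DERIV_exp]]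
  show ?thesis
    by (simp add: cis_conv_exp mult_ac)
qed

text \<open>
  The local lifts are differentiable only at one point each, so they cannot be glued
  directly; the characters of the torus turn them into globally differentiable functions.
\<close>

lemma torus_map_affine:
  fixes f :: "'a::real_normed_vector \<Rightarrow> 'n::finite torus"
  assumes loc: "\<And>x. \<exists>g. (\<forall>\<^sub>F y in nhds x. f y = torus_proj (g y)) \<and> (g has_derivative D) (at x)"
    and c: "f 0 = torus_proj c"
  shows "f x = torus_proj (D x + c)"
proof -
  have D: "bounded_linear D"
    using loc has_derivative_bounded_linear by blast
  \<comment> \<open>If \<open>f\<close> is \<open>D y + c\<close> modulo the lattice, dividing its
    character by that of \<open>D y\<close> leaves a constant; so the aim is that \<open>F i\<close>
    has derivative zero.\<close>
  define F where "F i y = torus_char (f y) i * cis (2 * pi * (- D y) $ i)" for i y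
  have "F i x = F i 0" for i
  proof -
    have "(F i has_derivative (\<lambda>h. 0)) (at y within UNIV)" for y
    proof -
      obtain g where g: "\<forall>\<^sub>F z in nhds y. f z = torus_proj (g z)" "(g has_derivative D) (at y)"
        using loc by blast
      have 1: "((\<lambda>z. cis (2 * pi * g z $ i) * cis (2 * pi * (- D z) $ i)) has_derivative (\<lambda>h. 0)) (at y)"
        by (rule has_derivative_eq_rhs, rule has_derivative_mult,
            rule has_derivative_cis_component[OF g(2)],
            rule has_derivative_cis_component,
            rule has_derivative_minus, rule bounded_linear_imp_has_derivative[OF D])
           (simp add: fun_eq_iff algebra_simps)
      have 2: "\<forall>\<^sub>F z in nhds y. cis (2 * pi * g z $ i) * cis (2 * pi * (- D z) $ i) = F i z"
        using g(1) by eventually_elim (simp add: F_def torus_char_proj)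
      show ?thesis
        by (rule has_derivative_transform_eventually[OF 1])
           (use 2 in \<open>auto simp: eventually_at_filter elim: eventually_mono dest: eventually_nhds_x_imp_x\<close>)
    qed
    then show ?thesis
      using has_derivative_zero_unique[of UNIV "F i" x 0] by auto
  qed
  then have F: "torus_char (f x) i * cis (2 * pi * (- D x) $ i) = cis (2 * pi * c $ i)" for i
    using D by (simp add: F_def c torus_char_proj linear_simps)
  have "torus_char (f x) i = torus_char (torus_proj (D x + c)) i" for i
  proof -
    have "torus_char (f x) i = (torus_char (f x) i * cis (2 * pi * (- D x) $ i)) * cis (2 * pi * D x $ i)"
      by (simp add: cis_mult mult.assoc)
    also have "\<dots> = cis (2 * pi * (D x + c) $ i)"
      unfolding F by (simp add: cis_mult algebra_simps)
    finally show ?thesis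
      by (simp add: torus_char_proj)
  qed
  then show ?thesis
    by (intro torus_char_inject ext)
qed

section \<open>Rational independence and density of the irrational line\<close>

lemma rationally_independent_nz:
  assumes "rationally_independent a"
  shows "a $ i \<noteq> 0"
proof
  assume "a $ i = 0"
  then have "(\<Sum>j\<in>UNIV. of_int (if j = i then 1 else 0) * a $ j) = 0"
    by (intro sum.neutral) auto
  from assms[unfolded rationally_independent_def, rule_format, OF this, of i] show False
    by simp
qed

text \<open>Two equal coordinates would give an integer relation with coefficients 1 and -1.
  Kronecker's theorem concerns a set of values, so the coordinates must not collapse.\<close>

lemma rationally_independent_inject:
  fixes a :: "real ^ 'n::finite"
  assumes "rationally_independent a" "a $ i = a $ j"
  shows "i = j"
proof (rule ccontr)
  assume ne: "i \<noteq> j"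
  let ?m = "\<lambda>k. if k = i then 1 else if k = j then -1 else (0::int)"
  have "(\<Sum>k\<in>UNIV. of_int (?m k) * a $ k) = (\<Sum>k\<in>{i,j}. of_int (?m k) * a $ k)"
    by (rule sum.mono_neutral_right) auto
  also have "\<dots> = 0"
    using ne assms(2) by simp
  finally have "(\<Sum>k\<in>UNIV. of_int (?m k) * a $ k) = 0" .
  from assms(1)[unfolded rationally_independent_def, rule_format, OF this, of i] show False
    by simp
qed

text \<open>Kronecker's simultaneous approximation theorem for the coordinates of \<open>a\<close>:
  some real \<open>t\<close> brings every \<open>t * a $ i\<close> close to \<open>y $ i\<close> up
  to an integer, and \<open>m\<close> removes these integers.\<close>

lemma dense_winding:
  fixes a :: "real ^ 'n::finite"
  assumes "rationally_independent a"
  shows "closure {t *\<^sub>R a + m | t m. \<forall>i. m $ i \<in> \<int>} = UNIV"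
proof -
  \<comment> \<open>The reals as a module over the integers; independence there is rational
    independence.\<close>
  interpret M: Modules.module "(\<lambda>r. (*) (real_of_int r))"
    by (simp add: Modules.module.intro distrib_left mult.commute)
  \<comment> \<open>Kronecker's theorem numbers its reals by naturals, so \<open>b\<close>
    enumerates the index type.\<close>
  obtain b where b: "bij_betw b {..<CARD('n)} (UNIV :: 'n set)"
    by (metis bij_betw_iff_card card_lessThan finite finite_lessThan)
  define \<theta> where "\<theta> k = a $ b k" for k
  have inj: "inj_on \<theta> {..<CARD('n)}"
    using b rationally_independent_inject[OF assms]
    by (auto simp: inj_on_def \<theta>_def bij_betw_def)
  have bim: "b ` {..<CARD('n)} = UNIV"
    using b by (simp add: bij_betw_def)
  have "\<theta> ` {..<CARD('n)} = (($) a) ` (b ` {..<CARD('n)})"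
    by (simp add: \<theta>_def image_image)
  then have im: "\<theta> ` {..<CARD('n)} = range (($) a)"
    by (simp add: bim)
  have inja: "inj (($) a)"
    using rationally_independent_inject[OF assms] by (auto simp: inj_on_def)
  have ind: "M.independent (\<theta> ` {..<CARD('n)})"
  proof -
    have "f (a $ j) = 0" if 0: "(\<Sum>x\<in>range (($) a). real_of_int (f x) * x) = 0" for f j
    proof -
      have "(\<Sum>j\<in>UNIV. of_int (f (a $ j)) * a $ j) = 0"
        using 0 by (simp add: sum.reindex[OF inja])
      then show ?thesis
        using assms unfolding rationally_independent_def by fast
    qed
    then show ?thesis
      unfolding im by (subst M.dependent_finite) auto
  qed
  have "y \<in> closure {t *\<^sub>R a + m | t m. \<forall>i. m $ i \<in> \<int>}" for y :: "real ^ 'n"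
    unfolding closure_approachable
  proof (intro allI impI)
    fix e :: real assume e: "e > 0"
    \<comment> \<open>In the l1 bound, n errors below \<open>d\<close> add up to at most
      \<open>n * d\<close>; the \<open>+ 1\<close> keeps this strictly below
      \<open>e\<close>.\<close>
    define d where "d = e / (real CARD('n) + 1)"
    have d: "d > 0" "real CARD('n) * d < e"
      using e by (auto simp: d_def field_simps)
    obtain t h where th: "\<And>k. k < CARD('n) \<Longrightarrow> \<bar>t * \<theta> k - of_int (h k) - y $ b k\<bar> < d"
      using Kronecker_thm_1[OF ind inj d(1), of "\<lambda>k. y $ b k"] by metis
    define b' where "b' = inv_into {..<CARD('n)} b"
    have b': "b' i < CARD('n)" "b (b' i) = i" for i
      unfolding b'_def using bim by (metis UNIV_I inv_into_into lessThan_iff, metis UNIV_I f_inv_into_f)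
    define m :: "real ^ 'n" where "m = (\<chi> i. - of_int (h (b' i)))"
    have "dist (t *\<^sub>R a + m) y \<le> (\<Sum>i\<in>UNIV. \<bar>(t *\<^sub>R a + m - y) $ i\<bar>)"
      unfolding dist_norm by (rule norm_le_l1_cart)
    also have "\<dots> \<le> (\<Sum>i\<in>(UNIV :: 'n set). d)"
      using th[OF b'(1)] by (intro sum_mono) (simp add: m_def \<theta>_def b'(2) less_imp_le)
    also have "\<dots> < e"
      using d by simp
    finally show "\<exists>z\<in>{t *\<^sub>R a + m | t m. \<forall>i. m $ i \<in> \<int>}. dist z y < e"
      by (intro bexI[of _ "t *\<^sub>R a + m"]) (force simp: m_def)+
  qed
  then show ?thesis by auto
qed

section \<open>Affine maps of the torus\<close>

lemma int_matrix_map_Ints: "(\<And>j. z $ j \<in> \<int>) \<Longrightarrow> int_matrix_map B z $ i \<in> \<int>"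
  by (auto simp: matrix_vector_mult_def intro!: Ints_sum Ints_mult)

text \<open>An integer matrix maps the lattice into itself, so the affine map descends to the torus.
  The flow maps (with matrix \<open>mat 1\<close>) and all symmetries of the flow turn out to have
  this form.\<close>

lift_definition torus_affine :: "int ^ 'n ^ 'n \<Rightarrow> real ^ 'n \<Rightarrow> 'n::finite torus \<Rightarrow> 'n torus"
  is "\<lambda>B c x. int_matrix_map B x + c"
proof -
  fix B :: "int ^ 'n ^ 'n" and c x y :: "real ^ 'n"
  assume "lattice_equiv x y"
  then have "int_matrix_map B (x - y) $ i \<in> \<int>" for i
    by (intro int_matrix_map_Ints) (simp add: lattice_equiv_def)
  then show "lattice_equiv (int_matrix_map B x + c) (int_matrix_map B y + c)"
    by (simp add: lattice_equiv_def matrix_vector_mult_diff_distrib)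
qed

lemma torus_affine_proj: "torus_affine B c (torus_proj x) = torus_proj (int_matrix_map B x + c)"
  by transfer (simp add: lattice_equiv_def)

lemma map_matrix_of_int_mult:
  "map_matrix of_int (A ** B) = (map_matrix of_int A ** map_matrix of_int B :: real ^ 'n ^ 'm)"
  by (simp add: matrix_matrix_mult_def vec_eq_iff)

lemma map_matrix_of_int_1: "map_matrix of_int (mat 1) = (mat 1 :: real ^ 'n ^ 'n)"
  by (simp add: mat_def vec_eq_iff)

lemma int_matrix_map_inject: "int_matrix_map A = int_matrix_map B \<longleftrightarrow> A = B"
proof
  assume "int_matrix_map A = int_matrix_map B"
  then have "map_matrix of_int A = (map_matrix of_int B :: real ^ 'a ^ 'a)"
    by (simp add: matrix_eq)
  then show "A = B"
    by (simp add: vec_eq_iff)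
qed simp

lemma int_matrix_map_mult: "int_matrix_map (A ** B) x = int_matrix_map A (int_matrix_map B x)"
  by (simp add: map_matrix_of_int_mult matrix_vector_mul_assoc)

lemma int_matrix_map_1: "int_matrix_map (mat 1) x = x"
  by (simp add: map_matrix_of_int_1)

lemma torus_affine_comp:
  "torus_affine A c \<circ> torus_affine B d = torus_affine (A ** B) (int_matrix_map A d + c)"
proof
  fix p :: "'a torus"
  obtain x where "p = torus_proj x" by (rule torus_cases)
  then show "(torus_affine A c \<circ> torus_affine B d) p = torus_affine (A ** B) (int_matrix_map A d + c) p"
    by (simp add: torus_affine_proj int_matrix_map_mult matrix_vector_right_distrib add.assoc)
qed

lemma torus_affine_id: "torus_affine (mat 1) 0 = id"
proof
  fix p :: "'a torus"
  obtain x where "p = torus_proj x" by (rule torus_cases)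
  then show "torus_affine (mat 1) 0 p = id p"
    by (simp add: torus_affine_proj int_matrix_map_1)
qed

section \<open>Derivatives, smoothness and inverses of affine torus maps\<close>

lemma has_derivative_affine_map:
  "((\<lambda>y. int_matrix_map B y + c) has_derivative int_matrix_map B) (at x)"
  by (intro has_derivative_eq_rhs[OF has_derivative_add[OF
      bounded_linear_imp_has_derivative has_derivative_const]]) auto

text \<open>Two local lifts of one map differ by a lattice-valued function \<open>d\<close>.
  Differentiability at \<open>x\<close> makes \<open>d\<close> continuous at \<open>x\<close>, hence
  constant near \<open>x\<close>, so the derivative does not depend on the lift.\<close>

lemma local_lift_torus_affine:
  assumes ev: "\<forall>\<^sub>F y in nhds x. torus_affine B c (torus_proj y) = torus_proj (g y)"
    and g: "(g has_derivative D) (at x)"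
  shows "D = int_matrix_map B"
proof -
  define d where "d y = g y - (int_matrix_map B y + c)" for y
  have dI: "\<forall>\<^sub>F y in nhds x. \<forall>i. d y $ i \<in> \<int>"
    using ev
  proof eventually_elim
    case (elim y)
    then have "torus_proj (g y) = torus_proj (int_matrix_map B y + c)"
      by (simp add: torus_affine_proj)
    then show ?case
      by (simp add: torus_proj_eq_iff d_def)
  qed
  have "isCont d x"
    unfolding d_def
    by (rule has_derivative_continuous, rule has_derivative_diff[OF g has_derivative_affine_map])
  then have "(d \<longlongrightarrow> d x) (nhds x)"
    by (simp add: isCont_def tendsto_at_iff_tendsto_nhds)
  then have "\<forall>\<^sub>F y in nhds x. dist (d y) (d x) < 1"
    by (rule tendstoD) simp
  \<comment> \<open>Integers at distance below 1 coincide, so \<open>d y = d x\<close> and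
    \<open>g\<close> is itself affine near \<open>x\<close>.\<close>
  with dI have ev': "\<forall>\<^sub>F y in nhds x. int_matrix_map B y + (c + d x) = g y"
  proof eventually_elim
    case (elim y)
    have "d y $ i = d x $ i" for i
    proof -
      have "\<bar>d y $ i - d x $ i\<bar> < 1"
        using elim(2) component_le_norm_cart[of "d y - d x" i] by (simp add: dist_norm)
      then show ?thesis
        using elim(1) eventually_nhds_x_imp_x[OF dI] Ints_eq_abs_less1 by blast
    qed
    then have "d y = d x"
      by (simp add: vec_eq_iff)
    then show ?case
      by (simp add: d_def algebra_simps)
  qed
  have "(g has_derivative int_matrix_map B) (at x)"
    by (rule has_derivative_transform_eventually[OF has_derivative_affine_map])
       (use ev' in \<open>auto simp: eventually_at_filter elim: eventually_mono dest: eventually_nhds_x_imp_x\<close>)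
  with g show ?thesis
    by (rule has_derivative_unique)
qed

lemma torus_affine_inject_matrix:
  assumes "torus_affine B c = torus_affine B' c'"
  shows "B = B'"
proof -
  have "int_matrix_map B' = int_matrix_map B"
    by (rule local_lift_torus_affine[OF _ has_derivative_affine_map[of B' c' 0], of B c])
       (simp add: assms torus_affine_proj)
  then show ?thesis
    by (simp only: int_matrix_map_inject)
qed

text \<open>The definite description is met by the affine formula, and by nothing else since all
  local lifts have the same derivative.\<close>

lemma tangent_map_torus_affine: "tangent_map (torus_affine B c) p = int_matrix_map B"
  unfolding tangent_map_def
proof (rule the_equality)
  obtain x where "p = torus_proj x" by (rule torus_cases)
  then show "\<exists>x g. torus_proj x = p \<and>
     (\<forall>\<^sub>F y in nhds x. torus_affine B c (torus_proj y) = torus_proj (g y)) \<and>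
     (g has_derivative int_matrix_map B) (at x)"
    by (intro exI[of _ x] exI[of _ "\<lambda>y. int_matrix_map B y + c"])
       (simp add: torus_affine_proj has_derivative_affine_map)
qed (use local_lift_torus_affine in blast)

lemma Ck_on_const: "Ck_on k U (\<lambda>x. c)"
  by (induction k arbitrary: c) auto

text \<open>The derivative in a fixed direction is constant in \<open>x\<close>, so a case
  distinction on \<open>k\<close> replaces induction.\<close>

lemma Ck_on_affine: "Ck_on k U (\<lambda>y. int_matrix_map B y + c)"
proof (cases k)
  case 0
  then show ?thesis
    by (simp add: continuous_on_add linear_continuous_on)
next
  case (Suc m)
  have "frechet_derivative (\<lambda>y. int_matrix_map B y + c) (at x) = int_matrix_map B" for x
    using frechet_derivative_at[OF has_derivative_affine_map] by metis
  then show ?thesis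
    using has_derivative_affine_map[of B c] by (auto simp: Suc Ck_on_const differentiable_def)
qed

lemma torus_smooth_torus_affine: "torus_smooth (torus_affine B c)"
  unfolding torus_smooth_def
  by (rule allI, rule exI[of _ UNIV], rule exI[of _ "\<lambda>y. int_matrix_map B y + c"])
     (simp add: Ck_on_affine torus_affine_proj)

lemma torus_affine_inverse:
  fixes B :: "int ^ 'n ^ 'n"
  assumes "invertible B"
  obtains B' where "B ** B' = mat 1" "B' ** B = mat 1"
    "bij (torus_affine B c)" "inv_into UNIV (torus_affine B c) = torus_affine B' (- int_matrix_map B' c)"
proof -
  obtain B' where B': "B ** B' = mat 1" "B' ** B = mat 1"
    using assms unfolding invertible_def by blast
  have "int_matrix_map B (int_matrix_map B' c) = c"
    by (simp add: B' int_matrix_map_1 flip: int_matrix_map_mult)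
  then have *: "torus_affine B c \<circ> torus_affine B' (- int_matrix_map B' c) = id"
    "torus_affine B' (- int_matrix_map B' c) \<circ> torus_affine B c = id"
    by (simp_all add: torus_affine_comp B' torus_affine_id linear_neg)
  then show thesis
    using that[OF B'] o_bij inv_unique_comp by blast
qed

lemma torus_diffeo_torus_affine: "invertible B \<Longrightarrow> torus_diffeo (torus_affine B c)"
  unfolding torus_diffeo_def by (metis torus_affine_inverse torus_smooth_torus_affine)

section \<open>Diffeomorphisms normalizing an irrational flow\<close>

text \<open>Each integral curve has velocity \<open>a\<close> at every time, so
  \<open>torus_map_affine\<close> on the real line, with \<open>D h = h *\<^sub>R a\<close>,
  identifies it with a projected straight line.\<close>

lemma flow_generated_by_constant_field:
  assumes "flow_generated_by \<phi> (constant_field a)"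
  shows "\<phi> = (\<lambda>t. torus_affine (mat 1) (t *\<^sub>R a))"
proof (intro ext)
  fix t and p :: "'a torus"
  obtain x where x: "p = torus_proj x" by (rule torus_cases)
  have "\<phi> t p = torus_proj (t *\<^sub>R a + x)"
  proof (rule torus_map_affine[where f = "\<lambda>s. \<phi> s p" and D = "\<lambda>h. h *\<^sub>R a"])
    show "\<exists>g. (\<forall>\<^sub>F s in nhds t. \<phi> s p = torus_proj (g s)) \<and> (g has_derivative (\<lambda>h. h *\<^sub>R a)) (at t)" for t
      using assms unfolding flow_generated_by_def has_velocity_def constant_field_def
        has_vector_derivative_def by blast
    show "\<phi> 0 p = torus_proj x"
      using assms x by (simp add: flow_generated_by_def)
  qed
  then show "\<phi> t p = torus_affine (mat 1) (t *\<^sub>R a) p"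
    by (simp add: x torus_affine_proj int_matrix_map_1 add.commute)
qed

lemma m_inv_Diff_torus:
  assumes "torus_diffeo R"
  shows "inv\<^bsub>Diff_torus\<^esub> R = inv_into UNIV R"
  unfolding m_inv_def Diff_torus_def
proof (simp, rule the_equality)
  have b: "bij R" using assms by (simp add: torus_diffeo_def)
  then show "torus_diffeo (inv_into UNIV R) \<and> R \<circ> inv_into UNIV R = id \<and> inv_into UNIV R \<circ> R = id"
    using assms by (simp add: torus_diffeo_def bij_imp_bij_inv inv_inv_eq bij_is_inj bij_is_surj
        surj_iff[symmetric])
  show "S = inv_into UNIV R" if "torus_diffeo S \<and> R \<circ> S = id \<and> S \<circ> R = id" for S
    using that inv_unique_comp by metis
qed

text \<open>The library's \<open>normalizer\<close> is a stabilizer under conjugation of subsets of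
  the carrier, with the action undefined on other sets. The assumption puts
  \<open>range \<phi>\<close> in its domain.\<close>

lemma flow_symmetries_iff_conjugation:
  fixes \<phi> :: "real \<Rightarrow> 'n::finite torus \<Rightarrow> 'n torus"
  assumes "range \<phi> \<subseteq> {R. torus_diffeo R}"
  shows "R \<in> flow_symmetries \<phi> \<longleftrightarrow>
    torus_diffeo R \<and> (\<lambda>f. R \<circ> f \<circ> inv_into UNIV R) ` range \<phi> = range \<phi>"
proof -
  have "(R <#\<^bsub>Diff_torus\<^esub> range \<phi>) #>\<^bsub>Diff_torus\<^esub> inv_into UNIV R = (\<lambda>f. R \<circ> f \<circ> inv_into UNIV R) ` range \<phi>"
    unfolding l_coset_def r_coset_def by (auto simp: Diff_torus_def)
  moreover have "carrier Diff_torus = {R :: 'n torus \<Rightarrow> 'n torus. torus_diffeo R}"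
    by (simp add: Diff_torus_def)
  ultimately show ?thesis
    using assms unfolding flow_symmetries_def normalizer_def stabilizer_def flow_maps_def
    by (simp add: m_inv_Diff_torus cong: conj_cong)
qed

section \<open>Lattice-valued multiples and additive maps\<close>

text \<open>If \<open>t * a $ i = k\<close> and \<open>t * a $ j = l\<close> with
  \<open>i \<noteq> j\<close>, then \<open>l * a $ i - k * a $ j = 0\<close> is an integer relation,
  so \<open>l = 0\<close> and \<open>t = 0\<close>. The dimension bound supplies the two
  indices.\<close>

lemma rationally_independent_Ints_scaleR:
  fixes a :: "real ^ 'n::finite"
  assumes "CARD('n) \<ge> 2" and ri: "rationally_independent a" and "\<And>i. t * a $ i \<in> \<int>"
  shows "t = 0"
proof (rule ccontr)
  assume t: "t \<noteq> 0"
  obtain i j :: 'n where ij: "i \<noteq> j"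
    using assms(1) by (metis One_nat_def card_2_iff' ex_card numeral_2_eq_2)
  obtain k l where kl: "t * a $ i = of_int k" "t * a $ j = of_int l"
    using assms(3) by (metis Ints_cases)
  let ?m = "\<lambda>h. if h = i then l else if h = j then - k else (0::int)"
  have "(\<Sum>h\<in>UNIV. of_int (?m h) * a $ h) = (\<Sum>h\<in>{i,j}. of_int (?m h) * a $ h)"
    by (rule sum.mono_neutral_right) auto
  also have "\<dots> = (t * a $ j) * a $ i - (t * a $ i) * a $ j"
    using ij kl by simp
  also have "\<dots> = 0"
    by simp
  finally have "(\<Sum>h\<in>UNIV. of_int (?m h) * a $ h) = 0" .
  from ri[unfolded rationally_independent_def, rule_format, OF this, of i] show False
    using kl t rationally_independent_nz[OF ri, of j] by simp
qed

text \<open>Since \<open>h x = n * h (x / n)\<close>, the integer \<open>h x\<close> is divisible by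
  every positive \<open>n\<close>; taking \<open>n\<close> above its absolute value leaves only
  0.\<close>

lemma additive_Ints_eq_0:
  fixes h :: "real \<Rightarrow> real"
  assumes add: "\<And>x y. h (x + y) = h x + h y" and Z: "\<And>x. h x \<in> \<int>"
  shows "h x = 0"
proof -
  have h0: "h 0 = 0"
    using add[of 0 0] by simp
  have mult: "h (real n * y) = real n * h y" for n y
    by (induction n) (simp_all add: h0 add algebra_simps)
  obtain n :: nat where n: "\<bar>h x\<bar> < real n"
    using reals_Archimedean2 by blast
  then have "n \<noteq> 0"
    by auto
  then have "\<bar>h x\<bar> = real n * \<bar>h (x / n)\<bar>"
    using mult[of n "x / n"] by (simp add: abs_mult)
  with n have "\<bar>h (x / n)\<bar> < 1"
    by (smt (verit) mult_less_cancel_left2 of_nat_0_le_iff)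
  then have "h (x / n) = 0"
    using Z Ints_nonzero_abs_less1 by blast
  then show ?thesis
    using mult[of n "x / n"] \<open>n \<noteq> 0\<close> by simp
qed

section \<open>Affinity of the normalizing diffeomorphisms\<close>

lemma torus_char_affine_1:
  "torus_char (torus_affine (mat 1) d p) i = torus_char p i * cis (2 * pi * d $ i)"
proof -
  obtain x where "p = torus_proj x" by (rule torus_cases)
  then show ?thesis
    by (simp add: torus_affine_proj int_matrix_map_1 torus_char_proj cis_mult algebra_simps)
qed

text \<open>Local lifts are continuous and characters do not see the choice of lift, so the
  composite is continuous on the whole covering space.\<close>

lemma torus_smooth_imp_continuous_char:
  assumes "torus_smooth R"
  shows "continuous_on UNIV (\<lambda>x. torus_char (R (torus_proj x)) i)"
proof (rule continuous_at_imp_continuous_on, rule ballI)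
  fix x
  obtain U g where U: "open U" "x \<in> U" "Ck_on 0 U g" "\<And>y. y \<in> U \<Longrightarrow> R (torus_proj y) = torus_proj (g y)"
    using assms unfolding torus_smooth_def by meson
  have "continuous_on U (\<lambda>y. cis (2 * pi * g y $ i))"
    using U(3) by (intro continuous_intros) simp
  then have "continuous_on U (\<lambda>x. torus_char (R (torus_proj x)) i)"
    by (rule continuous_on_eq) (simp add: U(4) torus_char_proj)
  then show "isCont (\<lambda>x. torus_char (R (torus_proj x)) i) x"
    using U(1,2) by (simp add: continuous_on_eq_continuous_at)
qed

text \<open>The multiplicative form of \<open>R (x + y) - R x = R y - R 0\<close>. For
  \<open>y\<close> on the irrational line, modulo the lattice, both sides are the translation by
  \<open>s *\<^sub>R a\<close>; density and continuity give all \<open>y\<close>.\<close>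

lemma torus_char_quasi_hom:
  fixes a :: "real ^ 'n::finite"
  assumes ri: "rationally_independent a" and R: "torus_smooth R"
    and comm: "\<And>t. \<exists>s. R \<circ> torus_affine (mat 1) (t *\<^sub>R a) = torus_affine (mat 1) (s *\<^sub>R a) \<circ> R"
  shows "torus_char (R (torus_proj (x + y))) i * torus_char (R (torus_proj 0)) i =
    torus_char (R (torus_proj x)) i * torus_char (R (torus_proj y)) i"
proof -
  define F where "F x = torus_char (R (torus_proj x)) i" for x
  have F: "continuous_on UNIV F"
    unfolding F_def by (rule torus_smooth_imp_continuous_char[OF R])
  have "F (x + y) * F 0 - F x * F y = 0"
  proof (rule continuous_constant_on_closure[where f = "\<lambda>y. F (x + y) * F 0 - F x * F y"])
    let ?S = "{t *\<^sub>R a + m | t m. \<forall>i. m $ i \<in> \<int>}"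
    show "y \<in> closure ?S"
      by (simp add: dense_winding[OF ri])
    have "continuous_on UNIV (\<lambda>y. F (x + y))"
      by (rule continuous_on_compose2[OF F]) (auto intro!: continuous_intros)
    then show "continuous_on (closure ?S) (\<lambda>y. F (x + y) * F 0 - F x * F y)"
      unfolding dense_winding[OF ri] by (intro continuous_intros F)
    show "F (x + z) * F 0 - F x * F z = 0" if z: "z \<in> ?S" for z
    proof -
      obtain t m where z: "z = t *\<^sub>R a + m" "\<forall>i. m $ i \<in> \<int>"
        using z by blast
      obtain s where s: "R \<circ> torus_affine (mat 1) (t *\<^sub>R a) = torus_affine (mat 1) (s *\<^sub>R a) \<circ> R"
        using comm by blast
      \<comment> \<open>The number \<open>s\<close> depends on \<open>t\<close> alone, so the same
        factor serves \<open>w = x\<close> and \<open>w = 0\<close>.\<close>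
      have "F (w + z) = F w * cis (2 * pi * (s *\<^sub>R a) $ i)" for w
      proof -
        have "torus_proj (w + z) = torus_affine (mat 1) (t *\<^sub>R a) (torus_proj w)"
          using z by (simp add: torus_affine_proj int_matrix_map_1 torus_proj_eq_iff)
        then have "R (torus_proj (w + z)) = torus_affine (mat 1) (s *\<^sub>R a) (R (torus_proj w))"
          using fun_cong[OF s] by simp
        then show ?thesis
          by (simp add: F_def torus_char_affine_1)
      qed
      from this[of x] this[of 0] show ?thesis
        by simp
    qed
  qed
  then show ?thesis
    by (simp add: F_def)
qed

text \<open>Each unit vector projects to the same point as 0, so \<open>D\<close> sends it into the
  lattice and the columns of \<open>D\<close> are integral.\<close>

lemma linear_lift_int_matrix:
  assumes D: "bounded_linear D" and R: "\<And>x. R (torus_proj x) = torus_proj (D x + c)"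
  shows "\<exists>B. R = torus_affine B c"
proof -
  \<comment> \<open>The floor only changes the type: the entries are shown next to be
    integers.\<close>
  define B :: "int ^ 'a ^ 'a" where "B = (\<chi> i j. \<lfloor>D (axis j 1) $ i\<rfloor>)"
  have "D (axis j 1) $ i \<in> \<int>" for i j
  proof -
    have "torus_proj (axis j 1 :: real ^ 'a) = torus_proj 0"
      by (simp add: torus_proj_eq_iff axis_def)
    then have "torus_proj (D (axis j 1) + c) = torus_proj (D 0 + c)"
      by (metis R)
    then show ?thesis
      using D by (simp add: torus_proj_eq_iff linear_simps)
  qed
  then have "matrix D = map_matrix of_int B"
    by (simp add: matrix_def B_def vec_eq_iff)
  then have "D = int_matrix_map B"
    using D by (metis bounded_linear.linear matrix_vector_mul(2))
  then have "R p = torus_affine B c p" for p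
    by (metis R torus_affine_proj torus_cases)
  then show ?thesis
    by blast
qed

text \<open>
  Since \<open>R\<close> is a homomorphism up to translation, translating a local lift at the origin gives
  local lifts everywhere, all with the same derivative \<open>D\<close>.
\<close>

lemma flow_normalizing_imp_affine:
  fixes a :: "real ^ 'n::finite"
  assumes ri: "rationally_independent a" and R: "torus_smooth R"
    and comm: "\<And>t. \<exists>s. R \<circ> torus_affine (mat 1) (t *\<^sub>R a) = torus_affine (mat 1) (s *\<^sub>R a) \<circ> R"
  shows "\<exists>B c. R = torus_affine B c"
proof -
  obtain U g where U: "open U" "0 \<in> U" "Ck_on (Suc 0) U g"
    "\<And>y. y \<in> U \<Longrightarrow> R (torus_proj y) = torus_proj (g y)"
    using R unfolding torus_smooth_def by meson
  obtain D where D: "(g has_derivative D) (at 0)"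
    using U(2,3) by (auto simp: differentiable_def)
  have "R (torus_proj x) = torus_proj (D x + g 0)" for x
  proof (rule torus_map_affine[where f = "\<lambda>x. R (torus_proj x)"])
    show "\<exists>h. (\<forall>\<^sub>F y in nhds x. R (torus_proj y) = torus_proj (h y)) \<and> (h has_derivative D) (at x)" for x
    proof -
      obtain x' where x': "R (torus_proj x) = torus_proj x'" by (rule torus_cases)
      \<comment> \<open>The lift \<open>g\<close> at the origin is moved to \<open>x\<close>, and
        its value adjusted so that \<open>h x = x'\<close>.\<close>
      define h where "h y = g (y - x) + (x' - g 0)" for y
      have "(h has_derivative D) (at x)"
      proof -
        have "((\<lambda>y. y - x) has_derivative (\<lambda>v. v)) (at x)"
          by (auto intro!: derivative_eq_intros)
        then have "((\<lambda>y. g (y - x)) has_derivative D) (at x)"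
          by (rule has_derivative_compose) (simp add: D)
        then show ?thesis
          unfolding h_def by (auto intro!: derivative_eq_intros)
      qed
      moreover have "R (torus_proj y) = torus_proj (h y)" if "y - x \<in> U" for y
      proof (rule torus_char_inject, rule ext)
        fix i
        have "torus_char (R (torus_proj y)) i * torus_char (torus_proj (g 0)) i =
            torus_char (torus_proj x') i * torus_char (torus_proj (g (y - x))) i"
          using torus_char_quasi_hom[OF ri R comm, of x "y - x" i] U(4)[OF that] U(4)[OF U(2)] x'
          by simp
        then have "torus_char (R (torus_proj y)) i =
            cis (2 * pi * x' $ i) * cis (2 * pi * g (y - x) $ i) / cis (2 * pi * g 0 $ i)"
          by (simp add: torus_char_proj field_simps)
        then show "torus_char (R (torus_proj y)) i = torus_char (torus_proj (h y)) i"
          by (simp add: torus_char_proj h_def cis_mult cis_divide algebra_simps)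
      qed
      moreover have "\<forall>\<^sub>F y in nhds x. y - x \<in> U"
      proof -
        have "open ((\<lambda>y. y - x) -` U)"
          by (intro open_vimage U(1) continuous_intros)
        from eventually_nhds_in_open[OF this, of x] show ?thesis
          using U(2) by simp
      qed
      ultimately show ?thesis
        by (intro exI[of _ h]) (auto elim: eventually_mono)
    qed
    show "R (torus_proj 0) = torus_proj (g 0)"
      using U by blast
  qed
  then show ?thesis
    using linear_lift_int_matrix[of D R "g 0"] has_derivative_bounded_linear[OF D] by blast
qed

text \<open>
  The multiplier of the time is linear without any regularity argument: its deviation from
  the linear lift is an additive map from the reals to the lattice, hence zero.
\<close>

lemma scaleR_of_flow_normalizing:
  fixes a :: "real ^ 'n::finite"
  assumes card: "CARD('n) \<ge> 2" and ri: "rationally_independent a"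
    and comm: "\<And>t. \<exists>s. torus_affine B c \<circ> torus_affine (mat 1) (t *\<^sub>R a) =
      torus_affine (mat 1) (s *\<^sub>R a) \<circ> torus_affine B c"
  shows "\<exists>\<alpha>. int_matrix_map B a = \<alpha> *\<^sub>R a"
proof -
  obtain s where s: "\<And>t. torus_affine B c \<circ> torus_affine (mat 1) (t *\<^sub>R a) =
      torus_affine (mat 1) (s t *\<^sub>R a) \<circ> torus_affine B c"
    using comm by metis
  \<comment> \<open>Evaluating the commutation relation at \<open>torus_proj 0\<close> shows that
    \<open>m t\<close> lies in the lattice.\<close>
  define m where "m t = t *\<^sub>R int_matrix_map B a - s t *\<^sub>R a" for t
  have m: "m t $ i \<in> \<int>" for t i
  proof -
    have "torus_proj (t *\<^sub>R int_matrix_map B a + c) = torus_proj (c + s t *\<^sub>R a)"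
      using fun_cong[OF s[of t], of "torus_proj 0"]
      by (simp add: torus_affine_proj int_matrix_map_1 matrix_vector_mult_scaleR)
    then show ?thesis
      by (simp add: torus_proj_eq_iff m_def algebra_simps)
  qed
  have s_add: "s (t + u) = s t + s u" for t u
  proof -
    \<comment> \<open>The failure of \<open>s\<close> to be additive, times \<open>a\<close>, is a
      combination of lattice vectors, hence zero by rational independence.\<close>
    have "(s (t + u) - s t - s u) * a $ i \<in> \<int>" for i
    proof -
      have "(s (t + u) - s t - s u) * a $ i = m t $ i + m u $ i - m (t + u) $ i"
        by (simp add: m_def algebra_simps)
      then show ?thesis
        using m by simp
    qed
    from rationally_independent_Ints_scaleR[OF card ri this] show ?thesis
      by simp
  qed
  have "m 1 $ i = 0" for i
    by (rule additive_Ints_eq_0[of "\<lambda>t. m t $ i"]) (simp_all only: m, simp add: m_def s_add algebra_simps)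
  then have "m 1 = 0"
    by (simp add: vec_eq_iff)
  \<comment> \<open>\<open>m 1 = 0\<close> says that \<open>a\<close> is an eigenvector with
    eigenvalue \<open>s 1\<close>.\<close>
  then show ?thesis
    by (auto simp: m_def)
qed

lemma torus_affine_commute_flow:
  assumes "int_matrix_map B a = \<alpha> *\<^sub>R a"
  shows "torus_affine B c \<circ> torus_affine (mat 1) (t *\<^sub>R a) =
    torus_affine (mat 1) ((\<alpha> * t) *\<^sub>R a) \<circ> torus_affine B c"
  by (simp add: torus_affine_comp int_matrix_map_1 matrix_vector_mult_scaleR assms algebra_simps)

section \<open>The symmetries as affine maps with eigenvector \<open>a\<close>\<close>

lemma flow_symmetries_iff_affine:
  fixes a :: "real ^ 'n::finite"
  assumes card: "CARD('n) \<ge> 2" and ri: "rationally_independent a"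
    and flow: "flow_generated_by \<phi> (constant_field a)"
  shows "R \<in> flow_symmetries \<phi> \<longleftrightarrow>
    (\<exists>B c \<alpha>. R = torus_affine B c \<and> invertible B \<and> \<alpha> \<noteq> 0 \<and> int_matrix_map B a = \<alpha> *\<^sub>R a)"
proof -
  have \<phi>: "\<phi> t = torus_affine (mat 1) (t *\<^sub>R a)" for t
    by (simp add: flow_generated_by_constant_field[OF flow])
  have inv1: "invertible (mat 1 :: int ^ 'n ^ 'n)"
    by (auto simp: invertible_def)
  have conj: "R \<in> flow_symmetries \<phi> \<longleftrightarrow>
      torus_diffeo R \<and> (\<lambda>f. R \<circ> f \<circ> inv_into UNIV R) ` range \<phi> = range \<phi>"
    by (rule flow_symmetries_iff_conjugation) (auto simp: \<phi> torus_diffeo_torus_affine[OF inv1])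
  show ?thesis
  proof
    assume "R \<in> flow_symmetries \<phi>"
    then have R: "torus_diffeo R" and img: "(\<lambda>f. R \<circ> f \<circ> inv_into UNIV R) ` range \<phi> = range \<phi>"
      by (auto simp: conj)
    let ?S = "inv_into UNIV R"
    have RS: "R \<circ> ?S = id" "?S \<circ> R = id"
      using R by (auto simp: torus_diffeo_def bij_is_inj bij_is_surj surj_iff[symmetric])
    have R_comm: "\<exists>s. R \<circ> \<phi> t = \<phi> s \<circ> R" for t
    proof -
      obtain s where "R \<circ> \<phi> t \<circ> ?S = \<phi> s"
        using img by blast
      moreover have "R \<circ> \<phi> t = (R \<circ> \<phi> t \<circ> ?S) \<circ> R"
        by (simp only: comp_assoc RS comp_id)
      ultimately show ?thesis
        by auto
    qed
    \<comment> \<open>The other inclusion of the set equation: each \<open>\<phi> t\<close> is a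
      conjugate by \<open>R\<close>, so the inverse also normalizes the flow.\<close>
    have S_comm: "\<exists>s. ?S \<circ> \<phi> t = \<phi> s \<circ> ?S" for t
    proof -
      obtain s where "\<phi> t = R \<circ> \<phi> s \<circ> ?S"
        using img by blast
      then have "?S \<circ> \<phi> t = (?S \<circ> R) \<circ> \<phi> s \<circ> ?S"
        by (simp only: comp_assoc)
      then show ?thesis
        by (auto simp: RS)
    qed
    obtain B c where B: "R = torus_affine B c"
      using flow_normalizing_imp_affine[OF ri, of R] R R_comm unfolding torus_diffeo_def \<phi> by blast
    obtain B' c' where B': "?S = torus_affine B' c'"
      using flow_normalizing_imp_affine[OF ri, of ?S] R S_comm unfolding torus_diffeo_def \<phi> by blast
    \<comment> \<open>An affine map determines its matrix, and the identity has matrix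
      \<open>mat 1\<close>.\<close>
    have "B ** B' = mat 1" "B' ** B = mat 1"
      using RS unfolding B B'[unfolded B] torus_affine_comp
      by (metis torus_affine_inject_matrix torus_affine_id)+
    then have "invertible B"
      unfolding invertible_def by blast
    obtain \<alpha> where \<alpha>: "int_matrix_map B a = \<alpha> *\<^sub>R a"
      using scaleR_of_flow_normalizing[OF card ri, of B c] R_comm unfolding \<phi> B by blast
    have "\<alpha> \<noteq> 0"
    proof
      assume "\<alpha> = 0"
      then have "int_matrix_map (B' ** B) a = 0"
        by (simp add: int_matrix_map_mult \<alpha>)
      then show False
        using \<open>B' ** B = mat 1\<close> rationally_independent_nz[OF ri] by (simp add: int_matrix_map_1)
    qed
    with B \<open>invertible B\<close> \<alpha> show "\<exists>B c \<alpha>. R = torus_affine B c \<and> invertible B \<and> \<alpha> \<noteq> 0 \<and>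
        int_matrix_map B a = \<alpha> *\<^sub>R a"
      by blast
  next
    assume "\<exists>B c \<alpha>. R = torus_affine B c \<and> invertible B \<and> \<alpha> \<noteq> 0 \<and> int_matrix_map B a = \<alpha> *\<^sub>R a"
    then obtain B c \<alpha> where B: "R = torus_affine B c" "invertible B" "\<alpha> \<noteq> 0" "int_matrix_map B a = \<alpha> *\<^sub>R a"
      by blast
    have R: "torus_diffeo R"
      by (simp add: B torus_diffeo_torus_affine)
    then have RS: "R \<circ> inv_into UNIV R = id"
      by (auto simp: torus_diffeo_def bij_is_surj surj_iff[symmetric])
    have *: "R \<circ> \<phi> t \<circ> inv_into UNIV R = \<phi> (\<alpha> * t)" for t
    proof -
      have "R \<circ> \<phi> t = \<phi> (\<alpha> * t) \<circ> R"
        unfolding \<phi> B(1) by (rule torus_affine_commute_flow[OF B(4)])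
      then show ?thesis
        by (simp add: comp_assoc RS)
    qed
    \<comment> \<open>Conjugation rescales time by \<open>\<alpha>\<close>, which permutes the real
      times because \<open>\<alpha>\<close> is nonzero.\<close>
    have "range (\<lambda>t. \<phi> (\<alpha> * t)) = range \<phi>"
    proof
      show "range \<phi> \<subseteq> range (\<lambda>t. \<phi> (\<alpha> * t))"
      proof (rule image_subsetI)
        show "\<phi> t \<in> range (\<lambda>t. \<phi> (\<alpha> * t))" for t
          by (rule range_eqI[of _ _ "t / \<alpha>"]) (simp add: B(3))
      qed
    qed auto
    with R show "R \<in> flow_symmetries \<phi>"
      unfolding conj image_image * by blast
  qed
qed

section \<open>The symmetry group and its linear section\<close>

text \<open>Each row of \<open>A - B\<close> is an integer relation among the coordinates of
  \<open>a\<close>. This is what makes \<open>\<nu>\<close> injective.\<close>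

lemma rationally_independent_matrix_inject:
  assumes ri: "rationally_independent a" and eq: "int_matrix_map A a = int_matrix_map B a"
  shows "A = B"
proof -
  have "A $ i $ j = B $ i $ j" for i j
  proof -
    have "int_matrix_map A a $ i - int_matrix_map B a $ i = 0"
      using eq by simp
    then have "(\<Sum>j\<in>UNIV. of_int (A $ i $ j - B $ i $ j) * a $ j) = 0"
      by (simp add: matrix_vector_mult_def algebra_simps sum_subtractf)
    from ri[unfolded rationally_independent_def, rule_format, OF this, of j] show ?thesis
      by simp
  qed
  then show ?thesis
    by (simp add: vec_eq_iff)
qed

lemma lift_derivative_is_torus_affine: "lift_derivative_is (torus_affine B c) A \<longleftrightarrow> A = B"
proof
  assume "lift_derivative_is (torus_affine B c) A"
  then obtain L where "is_lift L (torus_affine B c)" "(L has_derivative int_matrix_map A) (at 0)"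
    unfolding lift_derivative_is_def by blast
  then have "int_matrix_map A = int_matrix_map B"
    using local_lift_torus_affine[of B c L 0] by (simp add: is_lift_def)
  then show "A = B"
    by (simp only: int_matrix_map_inject)
next
  assume "A = B"
  then show "lift_derivative_is (torus_affine B c) A"
    unfolding lift_derivative_is_def is_lift_def
    by (intro exI[of _ "\<lambda>y. int_matrix_map B y + c"])
       (simp add: torus_affine_proj has_derivative_affine_map continuous_on_add linear_continuous_on)
qed

lemma torus_affine_unique_lift:
  assumes "is_lift (int_matrix_map B) R"
  shows "R = torus_affine B 0"
proof
  fix p :: "'a torus"
  obtain x where "p = torus_proj x" by (rule torus_cases)
  with assms show "R p = torus_affine B 0 p"
    by (simp add: is_lift_def torus_affine_proj)
qed

lemma group_Rstar: "group Rstar"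
proof (rule groupI)
  show "\<exists>y\<in>carrier Rstar. y \<otimes>\<^bsub>Rstar\<^esub> x = \<one>\<^bsub>Rstar\<^esub>" if "x \<in> carrier Rstar" for x
    using that by (intro bexI[of _ "inverse x"]) (auto simp: Rstar_def)
qed (auto simp: Rstar_def)

section \<open>The symmetry group and the multiplier homomorphism\<close>

locale irrational_flow =
  fixes a :: "real ^ 'n::finite" and \<phi> :: "real \<Rightarrow> 'n torus \<Rightarrow> 'n torus"
  assumes card: "CARD('n) \<ge> 2" and ri: "rationally_independent a"
    and flow: "flow_generated_by \<phi> (constant_field a)"
begin

lemma symmetry_iff:
  "R \<in> flow_symmetries \<phi> \<longleftrightarrow>
    (\<exists>B c \<alpha>. R = torus_affine B c \<and> invertible B \<and> \<alpha> \<noteq> 0 \<and> int_matrix_map B a = \<alpha> *\<^sub>R a)"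
  by (rule flow_symmetries_iff_affine[OF card ri flow])

lemma scaleR_inject: "\<alpha> *\<^sub>R a = \<beta> *\<^sub>R a \<longleftrightarrow> \<alpha> = \<beta>"
  using rationally_independent_nz[OF ri] by (metis scaleR_cancel_right zero_index)

text \<open>The pushforward of the constant field is the constant \<open>B a\<close>, and
  \<open>a \<noteq> 0\<close> makes the factor unique.\<close>

lemma multiplier_torus_affine:
  assumes "invertible B" "\<alpha> \<noteq> 0" "int_matrix_map B a = \<alpha> *\<^sub>R a"
  shows "multiplier (constant_field a) (torus_affine B c) = \<alpha>"
  unfolding multiplier_def
  by (rule the_equality)
     (auto simp: pushforward_def tangent_map_torus_affine constant_field_def assms fun_eq_iff
        scaleR_inject simp del: scaleR_cancel_right)

lemma symmetryE:
  assumes "R \<in> flow_symmetries \<phi>"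
  obtains B c \<alpha> where "R = torus_affine B c" "invertible B" "\<alpha> \<noteq> 0"
    "int_matrix_map B a = \<alpha> *\<^sub>R a" "multiplier (constant_field a) R = \<alpha>"
  using assms multiplier_torus_affine unfolding symmetry_iff by blast

abbreviation "\<S> \<equiv> Diff_torus\<lparr>carrier := flow_symmetries \<phi>\<rparr>"
abbreviation "\<rho> \<equiv> multiplier (constant_field a)"

lemma multiplier_nonzero: "R \<in> flow_symmetries \<phi> \<Longrightarrow> \<rho> R \<noteq> 0"
  by (erule symmetryE) simp

text \<open>The matrices multiply and share the eigenvector \<open>a\<close>, so their eigenvalues
  multiply.\<close>

lemma symmetry_comp:
  assumes "R \<in> flow_symmetries \<phi>" "S \<in> flow_symmetries \<phi>"
  shows "R \<circ> S \<in> flow_symmetries \<phi> \<and> \<rho> (R \<circ> S) = \<rho> R * \<rho> S"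
proof -
  obtain B c \<alpha> where R: "R = torus_affine B c" "invertible B" "\<alpha> \<noteq> 0"
    "int_matrix_map B a = \<alpha> *\<^sub>R a" "\<rho> R = \<alpha>"
    using assms(1) by (rule symmetryE)
  obtain B' c' \<beta> where S: "S = torus_affine B' c'" "invertible B'" "\<beta> \<noteq> 0"
    "int_matrix_map B' a = \<beta> *\<^sub>R a" "\<rho> S = \<beta>"
    using assms(2) by (rule symmetryE)
  have "R \<circ> S = torus_affine (B ** B') (int_matrix_map B c' + c)"
    by (simp add: R(1) S(1) torus_affine_comp)
  moreover have "invertible (B ** B')" "\<alpha> * \<beta> \<noteq> 0"
    using R S by (simp_all add: invertible_mult)
  moreover have "int_matrix_map (B ** B') a = (\<alpha> * \<beta>) *\<^sub>R a"
    by (simp add: int_matrix_map_mult R S matrix_vector_mult_scaleR mult.commute)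
  ultimately show ?thesis
    using multiplier_torus_affine R(5) S(5) unfolding symmetry_iff by metis
qed

lemma group_symmetries: "group \<S>"
proof (rule groupI)
  show "\<one>\<^bsub>\<S>\<^esub> \<in> carrier \<S>"
  proof -
    have "invertible (mat 1 :: int ^ 'n ^ 'n)"
      by (auto simp: invertible_def)
    moreover have "int_matrix_map (mat 1) a = 1 *\<^sub>R a"
      by (simp add: int_matrix_map_1)
    ultimately have "id \<in> flow_symmetries \<phi>"
      unfolding symmetry_iff by (metis torus_affine_id zero_neq_one)
    then show ?thesis
      by (simp add: Diff_torus_def)
  qed
  show "\<exists>S\<in>carrier \<S>. S \<otimes>\<^bsub>\<S>\<^esub> R = \<one>\<^bsub>\<S>\<^esub>" if mem: "R \<in> carrier \<S>" for R
  proof -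
    obtain B c \<alpha> where R: "R = torus_affine B c" "invertible B" "\<alpha> \<noteq> 0" "int_matrix_map B a = \<alpha> *\<^sub>R a"
      using mem by (auto simp: symmetry_iff)
    obtain B' where B': "B ** B' = mat 1" "B' ** B = mat 1"
      using R(2) unfolding invertible_def by blast
    let ?S = "torus_affine B' (- int_matrix_map B' c)"
    \<comment> \<open>Applying \<open>B'\<close> to \<open>B a = \<alpha> a\<close>; the inverse
      thus has eigenvalue \<open>1 / \<alpha>\<close>.\<close>
    have "\<alpha> *\<^sub>R int_matrix_map B' a = a"
      using B'(2) int_matrix_map_mult[of B' B a]
      by (simp add: R(4) int_matrix_map_1 matrix_vector_mult_scaleR)
    then have "int_matrix_map B' a = (1 / \<alpha>) *\<^sub>R a"
      by (metis R(3) divideR_right inverse_eq_divide)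
    moreover have "invertible B'"
      using B' unfolding invertible_def by blast
    ultimately have "?S \<in> flow_symmetries \<phi>"
      using R(3) unfolding symmetry_iff by (metis divide_eq_0_iff zero_neq_one)
    moreover have "?S \<circ> R = id"
      by (simp add: R(1) torus_affine_comp B' torus_affine_id)
    ultimately show ?thesis
      by (auto simp: Diff_torus_def)
  qed
qed (auto simp: Diff_torus_def symmetry_comp comp_assoc)

sublocale multiplier: group_hom \<S> Rstar \<rho>
proof -
  have "\<rho> \<in> hom \<S> Rstar"
    by (auto simp: hom_def Rstar_def Diff_torus_def symmetry_comp multiplier_nonzero)
  then show "group_hom \<S> Rstar \<rho>"
    by (simp add: group_hom_def group_hom_axioms_def group_symmetries group_Rstar)
qed

lemma subgroup_Rstar:
  assumes "subgroup \<Lambda> (multiplier_group \<phi> (constant_field a))"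
  shows "subgroup \<Lambda> Rstar"
proof (rule multiplier.H.incl_subgroup)
  show "subgroup (\<rho> ` flow_symmetries \<phi>) Rstar"
    using multiplier.img_is_subgroup by simp
  show "subgroup \<Lambda> (Rstar\<lparr>carrier := \<rho> ` flow_symmetries \<phi>\<rparr>)"
    using assms by (simp add: multiplier_group_def)
qed

lemma subgroup_symmetries_over:
  assumes "subgroup \<Lambda> Rstar"
  shows "subgroup {R \<in> flow_symmetries \<phi>. \<rho> R \<in> \<Lambda>} \<S>"
proof -
  interpret \<Lambda>: subgroup \<Lambda> Rstar by fact
  show ?thesis
  proof (rule multiplier.G.subgroupI)
    show "{R \<in> flow_symmetries \<phi>. \<rho> R \<in> \<Lambda>} \<noteq> {}"
      using multiplier.hom_one multiplier.G.one_closed \<Lambda>.one_closed by force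
    fix R S assume R: "R \<in> {R \<in> flow_symmetries \<phi>. \<rho> R \<in> \<Lambda>}"
    then have "R \<in> carrier \<S>" by simp
    then show "inv\<^bsub>\<S>\<^esub> R \<in> {R \<in> flow_symmetries \<phi>. \<rho> R \<in> \<Lambda>}"
      using R multiplier.G.inv_closed[of R] by (simp add: multiplier.hom_inv)
    assume S: "S \<in> {R \<in> flow_symmetries \<phi>. \<rho> R \<in> \<Lambda>}"
    show "R \<otimes>\<^bsub>\<S>\<^esub> S \<in> {R \<in> flow_symmetries \<phi>. \<rho> R \<in> \<Lambda>}"
      using R S multiplier.G.m_closed[of R S] multiplier.hom_mult[of R S] by simp
  qed auto
qed

section \<open>The extension over a subgroup of multipliers\<close>

lemma symmetries_over_eq:
  "symmetries_over \<phi> (constant_field a) \<Lambda> = \<S>\<lparr>carrier := {R \<in> flow_symmetries \<phi>. \<rho> R \<in> \<Lambda>}\<rparr>"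
  by (simp add: symmetries_over_def)

lemma multiplier_kernel_eq:
  "multiplier_kernel \<phi> (constant_field a) = \<S>\<lparr>carrier := kernel \<S> Rstar \<rho>\<rparr>"
  by (simp add: multiplier_kernel_def)

text \<open>Exactness in the middle rests on \<open>1 \<in> \<Lambda>\<close>, which puts the whole
  kernel into the preimage; surjectivity rests on \<open>\<Lambda>\<close> lying in the image of
  \<open>\<rho>\<close>.\<close>

lemma group_extension_multiplier:
  assumes "subgroup \<Lambda> (multiplier_group \<phi> (constant_field a))"
  shows "group_extension (multiplier_kernel \<phi> (constant_field a)) id
    (symmetries_over \<phi> (constant_field a) \<Lambda>) (multiplier_on \<phi> (constant_field a) \<Lambda>)
    (Rstar\<lparr>carrier := \<Lambda>\<rparr>)"
proof -
  let ?K = "multiplier_kernel \<phi> (constant_field a)"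
  let ?E = "symmetries_over \<phi> (constant_field a) \<Lambda>"
  let ?Q = "Rstar\<lparr>carrier := \<Lambda>\<rparr>"
  let ?j = "multiplier_on \<phi> (constant_field a) \<Lambda>"
  interpret \<Lambda>: subgroup \<Lambda> Rstar
    using assms by (rule subgroup_Rstar)
  have K: "group ?K"
    unfolding multiplier_kernel_eq
    by (rule multiplier.G.subgroup_imp_group[OF multiplier.subgroup_kernel])
  have E: "group ?E"
    unfolding symmetries_over_eq
    by (rule multiplier.G.subgroup_imp_group[OF subgroup_symmetries_over]) (rule \<Lambda>.subgroup_axioms)
  have Q: "group ?Q"
    by (rule multiplier.H.subgroup_imp_group) (rule \<Lambda>.subgroup_axioms)
  have carrier_K: "carrier ?K = {R \<in> flow_symmetries \<phi>. \<rho> R = 1}"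
    by (simp add: multiplier_kernel_eq kernel_def Rstar_def)
  have carrier_E: "carrier ?E = {R \<in> flow_symmetries \<phi>. \<rho> R \<in> \<Lambda>}"
    by (simp add: symmetries_over_eq)
  have j: "?j R = \<rho> R" if "R \<in> carrier ?E" for R
    using that by (simp add: multiplier_on_def)
  have one: "1 \<in> \<Lambda>"
    using \<Lambda>.one_closed by (simp add: Rstar_def)
  have mult: "(\<otimes>\<^bsub>?K\<^esub>) = (\<circ>)" "(\<otimes>\<^bsub>?E\<^esub>) = (\<circ>)" "(\<otimes>\<^bsub>?Q\<^esub>) = (*)"
    by (simp_all add: multiplier_kernel_eq symmetries_over_eq Diff_torus_def Rstar_def)
  have "id \<in> hom ?K ?E"
    using one by (auto simp: hom_def carrier_K carrier_E mult)
  moreover have "?j \<in> hom ?E ?Q"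
  proof (rule homI)
    fix R S assume RS: "R \<in> carrier ?E" "S \<in> carrier ?E"
    then have "R \<circ> S \<in> carrier ?E"
      using group.is_monoid[OF E, THEN monoid.m_closed, OF RS] by (simp only: mult)
    with RS show "?j (R \<otimes>\<^bsub>?E\<^esub> S) = ?j R \<otimes>\<^bsub>?Q\<^esub> ?j S"
      unfolding mult by (simp add: j) (simp add: carrier_E symmetry_comp)
  qed (simp add: j, simp add: carrier_E)
  moreover have "id ` carrier ?K = kernel ?E ?Q ?j"
    using one by (auto simp: kernel_def j carrier_K carrier_E Rstar_def multiplier_on_def)
  moreover have "?j ` carrier ?E = carrier ?Q"
  proof -
    have "?j ` carrier ?E = \<rho> ` carrier ?E"
      by (rule image_cong) (simp_all add: j)
    also have "\<dots> = \<Lambda>"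
      using subgroup.subset[OF assms] by (auto simp: carrier_E multiplier_group_def)
    finally show ?thesis
      by simp
  qed
  ultimately show ?thesis
    using K E Q by (simp add: group_extension_def group_hom_def group_hom_axioms_def)
qed

section \<open>The inverse of \<open>\<nu>\<close> and the splitting\<close>

text \<open>All symmetries with lift derivative \<open>B\<close> differ only in their translation
  part, which does not affect the multiplier; so the description is unique.\<close>

lemma matrix_multiplier_eq:
  assumes "invertible B" "\<alpha> \<noteq> 0" "int_matrix_map B a = \<alpha> *\<^sub>R a"
  shows "matrix_multiplier \<phi> (constant_field a) B = \<alpha>"
  unfolding matrix_multiplier_def
proof (rule the_equality)
  show "\<exists>R\<in>flow_symmetries \<phi>. lift_derivative_is R B \<and> \<alpha> = \<rho> R"
    using assms multiplier_torus_affine[OF assms]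
    by (intro bexI[of _ "torus_affine B 0"]) (auto simp: lift_derivative_is_torus_affine symmetry_iff)
  show "\<beta> = \<alpha>" if "\<exists>R\<in>flow_symmetries \<phi>. lift_derivative_is R B \<and> \<beta> = \<rho> R" for \<beta>
    using that assms multiplier_torus_affine[OF assms] unfolding Bex_def symmetry_iff
    by (metis lift_derivative_is_torus_affine)
qed

lemma symmetry_matrices_eq:
  "symmetry_matrices \<phi> = {B. invertible B \<and> (\<exists>\<alpha>. \<alpha> \<noteq> 0 \<and> int_matrix_map B a = \<alpha> *\<^sub>R a)}"
proof -
  have "(\<exists>R\<in>flow_symmetries \<phi>. lift_derivative_is R B) \<longleftrightarrow> (\<exists>\<alpha>. \<alpha> \<noteq> 0 \<and> int_matrix_map B a = \<alpha> *\<^sub>R a)"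
    if "invertible B" for B
    using that unfolding Bex_def symmetry_iff by (metis lift_derivative_is_torus_affine)
  then show ?thesis
    unfolding symmetry_matrices_def by blast
qed

text \<open>The multiplier fixes \<open>B a\<close>, and \<open>B a\<close> fixes
  \<open>B\<close>.\<close>

lemma multiplier_matrix_eq:
  assumes "invertible B" "\<alpha> \<noteq> 0" "int_matrix_map B a = \<alpha> *\<^sub>R a"
  shows "multiplier_matrix \<phi> (constant_field a) \<alpha> = B"
  unfolding multiplier_matrix_def
proof (rule inv_into_f_eq)
  show "inj_on (matrix_multiplier \<phi> (constant_field a)) (symmetry_matrices \<phi>)"
    by (rule inj_onI)
       (auto simp: symmetry_matrices_eq matrix_multiplier_eq intro: rationally_independent_matrix_inject[OF ri])
qed (use assms in \<open>auto simp: symmetry_matrices_eq matrix_multiplier_eq\<close>)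

lemma linear_section_eq:
  assumes "\<alpha> \<in> \<Lambda>" "invertible B" "\<alpha> \<noteq> 0" "int_matrix_map B a = \<alpha> *\<^sub>R a"
  shows "linear_section \<phi> (constant_field a) \<Lambda> \<alpha> = torus_affine B 0"
  unfolding linear_section_def restrict_apply' [OF assms(1)] multiplier_matrix_eq[OF assms(2-4)]
proof (rule the_equality)
  show "torus_diffeo (torus_affine B 0) \<and> is_lift (int_matrix_map B) (torus_affine B 0)"
    by (simp add: torus_diffeo_torus_affine assms(2) is_lift_def torus_affine_proj linear_continuous_on)
qed (use torus_affine_unique_lift in blast)

lemma splitting_map_linear_section:
  assumes \<Lambda>: "subgroup \<Lambda> (multiplier_group \<phi> (constant_field a))"
  shows "splitting_map (multiplier_kernel \<phi> (constant_field a)) id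
    (symmetries_over \<phi> (constant_field a) \<Lambda>) (multiplier_on \<phi> (constant_field a) \<Lambda>)
    (Rstar\<lparr>carrier := \<Lambda>\<rparr>) (linear_section \<phi> (constant_field a) \<Lambda>)"
proof -
  let ?E = "symmetries_over \<phi> (constant_field a) \<Lambda>"
  let ?h = "linear_section \<phi> (constant_field a) \<Lambda>"
  have carrier_E: "carrier ?E = {R \<in> flow_symmetries \<phi>. \<rho> R \<in> \<Lambda>}"
    by (simp add: symmetries_over_eq)
  have matrix: "\<exists>B. invertible B \<and> \<alpha> \<noteq> 0 \<and> int_matrix_map B a = \<alpha> *\<^sub>R a \<and> ?h \<alpha> = torus_affine B 0"
    if "\<alpha> \<in> \<Lambda>" for \<alpha>
  proof -
    have "\<alpha> \<in> \<rho> ` flow_symmetries \<phi>"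
      using subgroup.subset[OF \<Lambda>] that by (auto simp: multiplier_group_def)
    then obtain R where "R \<in> flow_symmetries \<phi>" "\<rho> R = \<alpha>"
      by blast
    then show ?thesis
      using linear_section_eq[OF that] by (metis symmetryE)
  qed
  have h: "?h \<alpha> \<in> carrier ?E" "\<rho> (?h \<alpha>) = \<alpha>" if \<alpha>: "\<alpha> \<in> \<Lambda>" for \<alpha>
    using matrix[OF \<alpha>] \<alpha> by (auto simp: carrier_E symmetry_iff multiplier_torus_affine)
  have "?h (\<alpha> * \<beta>) = ?h \<alpha> \<circ> ?h \<beta>" if mem: "\<alpha> \<in> \<Lambda>" "\<beta> \<in> \<Lambda>" for \<alpha> \<beta>
  proof -
    obtain A where A: "invertible A" "\<alpha> \<noteq> 0" "int_matrix_map A a = \<alpha> *\<^sub>R a" "?h \<alpha> = torus_affine A 0"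
      using matrix[OF mem(1)] by blast
    obtain B where B: "invertible B" "\<beta> \<noteq> 0" "int_matrix_map B a = \<beta> *\<^sub>R a" "?h \<beta> = torus_affine B 0"
      using matrix[OF mem(2)] by blast
    \<comment> \<open>Outside \<open>\<Lambda>\<close> the section is \<open>undefined\<close>.
      Inside, \<open>A ** B\<close> has eigenvalue \<open>\<alpha> * \<beta>\<close> and is
      therefore the matrix chosen there.\<close>
    have "\<alpha> * \<beta> \<in> \<Lambda>"
      using subgroup.m_closed[OF \<Lambda> mem] by (simp add: multiplier_group_def Rstar_def)
    then have "?h (\<alpha> * \<beta>) = torus_affine (A ** B) 0"
      by (rule linear_section_eq)
         (simp_all add: A B invertible_mult int_matrix_map_mult matrix_vector_mult_scaleR mult.commute)
    then show ?thesis
      by (simp add: A(4) B(4) torus_affine_comp)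
  qed
  then have "?h \<in> hom (Rstar\<lparr>carrier := \<Lambda>\<rparr>) ?E"
    using h by (auto simp: hom_def symmetries_over_def Rstar_def Diff_torus_def)
  then show ?thesis
    using group_extension_multiplier[OF \<Lambda>] h by (simp add: splitting_map_def multiplier_on_def)
qed

end

theorem theorem5p4:
  fixes a :: "real ^ 'n::finite"
    and X :: "'n torus \<Rightarrow> real ^ 'n"
    and \<phi> :: "real \<Rightarrow> 'n torus \<Rightarrow> 'n torus"
  assumes "CARD('n) \<ge> 2"
    and "rationally_independent a"
    and "X = constant_field a"
    and "flow_generated_by \<phi> X"
  shows "\<forall>\<Lambda>. subgroup \<Lambda> (multiplier_group \<phi> X) \<longrightarrow>
           splitting_map (multiplier_kernel \<phi> X) id (symmetries_over \<phi> X \<Lambda>)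
             (multiplier_on \<phi> X \<Lambda>) (Rstar\<lparr>carrier := \<Lambda>\<rparr>) (linear_section \<phi> X \<Lambda>)"
proof -
  interpret irrational_flow a \<phi>
    using assms by unfold_locales simp_all
  show ?thesis
    using splitting_map_linear_section assms(3) by simp
qed

end
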